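(* Let $X$ be an $(\boldsymbol{\mathcal{S}},\boldsymbol{\mathcal{S}}')$-recognizable subset of $\mathbb{N}^{d+d'}$. Then the sequence $f\colon\mathbb{N}^d\to\mathbb{N}_\infty$, $\boldsymbol{n}\mapsto\mathrm{Card}\{\boldsymbol{n}'\in\mathbb{N}^{d'}:(\boldsymbol{n},\boldsymbol{n}')\in X\}$, is $(\boldsymbol{\mathcal{S}},\mathbb{N}_\infty)$-regular. If moreover $f(\mathbb{N}^d)\subseteq\mathbb{N}$, then $f$ is $(\boldsymbol{\mathcal{S}},\mathbb{N})$-regular.
   Context: An abstract numeration system is a triple $\mathcal{S}=(L,A,<)$ where $L$ is an infinite regular language over a finite alphabet $A$ totally ordered by $<$. Words are ordered by the radix order ($u<_{\rm rad}v$ iff $|u|<|v|$, or $|u|=|v|$ and $u$ is lexicographically smaller); $\mathrm{rep}_{\mathcal{S}}\colon\mathbb{N}\to L$ maps $n$ to the $n$-th word of $L$ (indexing from $0$) and $\mathrm{val}_{\mathcal{S}}$ is its inverse. For $e\ge1$, abstract numeration systems $\mathcal{T}_j=(K_j,B_j,<_j)$ and a symbol $\#\notin\bigcup_jB_j$, the $e$-dimensional system $\boldsymbol{\mathcal{T}}=(\mathcal{T}_1,\dots,\mathcal{T}_e)$ has alphabet $\boldsymbol{B}=\big((B_1\cup\{\#\})\times\cdots\times(B_e\cup\{\#\})\big)\setminus\{(\#,\dots,\#)\}$, numeration language $\boldsymbol{K}$ consisting of the words over $\boldsymbol{B}$ obtained from $(w_1,\dots,w_e)\in K_1\times\cdots\times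 K_e$ by left-padding each $w_j$ with $\#$'s to the maximal length and reading them in parallel, and $\mathrm{rep}_{\boldsymbol{\mathcal{T}}}(n_1,\dots,n_e)$ is the word so obtained from $(\mathrm{rep}_{\mathcal{T}_1}(n_1),\dots,\mathrm{rep}_{\mathcal{T}_e}(n_e))$; this is a bijection $\mathbb{N}^e\to\boldsymbol{K}$ with inverse $\mathrm{val}_{\boldsymbol{\mathcal{T}}}$. A set $X\subseteq\mathbb{N}^e$ is $\boldsymbol{\mathcal{T}}$-recognizable if $\mathrm{rep}_{\boldsymbol{\mathcal{T}}}(X)$ is regular. $\boldsymbol{\mathcal{S}}=(\mathcal{S}_1,\dots,\mathcal{S}_d)$ and $\boldsymbol{\mathcal{S}}'=(\mathcal{S}'_1,\dots,\mathcal{S}'_{d'})$ are fixed systems of dimensions $d,d'$, and $(\boldsymbol{\mathcal{S}},\boldsymbol{\mathcal{S}}')=(\mathcal{S}_1,\dots,\mathcal{S}_d,\mathcal{S}'_1,\dots,\mathcal{S}'_{d'})$. $\mathbb{N}_\infty=\mathbb{N}\cup\{\infty\}$ is the semiring extending $+,\cdot$ of $\mathbb{N}$ by $\infty+n=n+\infty=\infty$, $\infty\cdot n=n\cdot\infty=\infty$ for $n\neq0$, and $\infty\cdot0=0\cdot\infty=0$. For a semiring $\mathbb{K}$, a series $S\colon A^*\to\mathbb{K}$ is $\mathbb{K}$-recognizable if there exist $r\ge1$, a monoid morphism $\mu\colon A^*\to\mathbb{K}^{r\times r}$, $\lambda\in\mathbb{K}^{1\times r}$, $\gamma\in\mathbb{K}^{r\times1}$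 with $(S,w)=\lambda\mu(w)\gamma$ for all $w$. A sequence $f\colon\mathbb{N}^e\to\mathbb{K}$ is $(\boldsymbol{\mathcal{T}},\mathbb{K})$-regular if the series $\sum_{\boldsymbol{w}\in\boldsymbol{K}}f(\mathrm{val}_{\boldsymbol{\mathcal{T}}}(\boldsymbol{w}))\,\boldsymbol{w}$ over $\boldsymbol{B}$ is $\mathbb{K}$-recognizable. *)

theory Defs
  imports
    "HOL-Library.Extended_Nat"
    "Jordan_Normal_Form.Matrix"
begin

text \<open>Regular languages over the finite alphabet \<open>A\<close>: acceptance by a complete deterministic
  finite automaton. Taking natural numbers as states is no restriction.\<close>

definition regular_language :: "'a set \<Rightarrow> 'a list set \<Rightarrow> bool" where
  "regular_language A L \<longleftrightarrow> finite A \<and> L \<subseteq> lists A \<and>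
    (\<exists>(Q :: nat set) q0 F \<delta>.
       finite Q \<and> q0 \<in> Q \<and> F \<subseteq> Q \<and> (\<forall>q\<in>Q. \<forall>a\<in>A. \<delta> q a \<in> Q) \<and>
       (\<forall>w\<in>lists A. w \<in> L \<longleftrightarrow> foldl \<delta> q0 w \<in> F))"

record 'a numsys =
  lang :: "'a list set"
  alph :: "'a set"
  less_rel :: "('a \<times> 'a) set"

definition abstract_numsys :: "'a numsys \<Rightarrow> bool" where
  "abstract_numsys S \<longleftrightarrow>
     finite (alph S) \<and>
     less_rel S \<subseteq> alph S \<times> alph S \<and> strict_linear_order_on (alph S) (less_rel S) \<and>
     regular_language (alph S) (lang S) \<and> infinite (lang S)"

text \<open>\<^const>\<open>lenlex\<close> is the radix order: shorter words first, words of equal length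
  lexicographically. The \<open>n\<close>-th word (from 0) of a language is its word with exactly \<open>n\<close>
  predecessors in the language.\<close>

definition rep :: "'a numsys \<Rightarrow> nat \<Rightarrow> 'a list" where
  "rep S n = (THE w. w \<in> lang S \<and> card {v \<in> lang S. (v, w) \<in> lenlex (less_rel S)} = n)"

text \<open>An \<open>e\<close>-dimensional system is a list of \<open>e\<close> systems, a point of \<open>\<nat>\<^sup>e\<close> is a list of
  length \<open>e\<close>, and concatenation of lists forms \<open>(S, S')\<close> and \<open>(n, n')\<close>. The one-dimensional systems
  may have different alphabets, all of them subsets of a common type \<open>'a\<close>. The padding symbol
  \<open>#\<close> is \<^const>\<open>None\<close>; a letter \<open>a\<close> becomes \<open>Some a\<close>.\<close>

definition multi_numsys :: "'a numsys list \<Rightarrow> bool" where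
  "multi_numsys Ts \<longleftrightarrow> Ts \<noteq> [] \<and> (\<forall>T\<in>set Ts. abstract_numsys T)"

definition points :: "nat \<Rightarrow> nat list set" where
  "points e = {ns. length ns = e}"

definition multi_alph :: "'a numsys list \<Rightarrow> 'a option list set" where
  "multi_alph Ts =
     {as. list_all2 (\<lambda>a T. a \<in> insert None (Some ` alph T)) as Ts} - {replicate (length Ts) None}"

definition left_pad :: "nat \<Rightarrow> 'a list \<Rightarrow> 'a option list" where
  "left_pad m w = replicate (m - length w) None @ map Some w"

definition parallel :: "'a list list \<Rightarrow> 'a option list list" where
  "parallel ws =
     (let m = Max (length ` set ws) in map (\<lambda>i. map (\<lambda>w. left_pad m w ! i) ws) [0..<m])"

definition multi_lang :: "'a numsys list \<Rightarrow> 'a option list list set" where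
  "multi_lang Ts = parallel ` {ws. list_all2 (\<lambda>w T. w \<in> lang T) ws Ts}"

definition multi_rep :: "'a numsys list \<Rightarrow> nat list \<Rightarrow> 'a option list list" where
  "multi_rep Ts ns = parallel (map2 rep Ts ns)"

definition multi_val :: "'a numsys list \<Rightarrow> 'a option list list \<Rightarrow> nat list" where
  "multi_val Ts = the_inv_into (points (length Ts)) (multi_rep Ts)"

definition recognizable_set :: "'a numsys list \<Rightarrow> nat list set \<Rightarrow> bool" where
  "recognizable_set Ts X \<longleftrightarrow>
     X \<subseteq> points (length Ts) \<and> regular_language (multi_alph Ts) (multi_rep Ts ` X)"

text \<open>The semiring is the type \<open>'k\<close>. A series over \<open>A\<close> is a function on all lists of which only the
  values on \<^term>\<open>lists A\<close> matter.\<close>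

definition recognizable_series :: "'b set \<Rightarrow> ('b list \<Rightarrow> 'k :: semiring_1) \<Rightarrow> bool" where
  "recognizable_series A s \<longleftrightarrow>
     (\<exists>r \<ge> 1. \<exists>\<mu> :: 'b list \<Rightarrow> 'k mat. \<exists>lam \<in> carrier_mat 1 r. \<exists>\<gamma> \<in> carrier_mat r 1.
        (\<forall>w\<in>lists A. \<mu> w \<in> carrier_mat r r) \<and>
        \<mu> [] = 1\<^sub>m r \<and> (\<forall>u\<in>lists A. \<forall>v\<in>lists A. \<mu> (u @ v) = \<mu> u * \<mu> v) \<and>
        (\<forall>w\<in>lists A. s w = (lam * \<mu> w * \<gamma>) $$ (0, 0)))"

definition regular_sequence :: "'a numsys list \<Rightarrow> (nat list \<Rightarrow> 'k :: semiring_1) \<Rightarrow> bool" where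
  "regular_sequence Ts f \<longleftrightarrow>
     recognizable_series (multi_alph Ts)
       (\<lambda>w. if w \<in> multi_lang Ts then f (multi_val Ts w) else 0)"

text \<open>Cardinality with values in the semiring \<open>\<nat>\<^sub>\<infinity>\<close>, which is \<^typ>\<open>enat\<close>
  (in particular \<open>\<infinity> * 0 = 0\<close>).\<close>

definition ecard :: "'a set \<Rightarrow> enat" where
  "ecard Y = (if finite Y then enat (card Y) else \<infinity>)"

end

theory Submission
  imports Defs
begin

text \<open>Deleting the last \<open>d'\<close> tracks of the word of \<open>(n, n')\<close> leaves the word of \<open>n\<close>, preceded by
  padding letters \<open>(#, \<dots>, #)\<close> when the word of \<open>n'\<close> is longer. Hence \<open>f n\<close> is the number of words
  of the regular language of \<open>X\<close> that project to a padding of the word of \<open>n\<close>, and counting paths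
  in an automaton for that language gives a linear representation.\<close>

section \<open>Cardinalities in \<open>\<nat>\<^sub>\<infinity>\<close>\<close>

lemma ecard_eq_enat: "finite A \<Longrightarrow> ecard A = enat (card A)"
  by (simp add: ecard_def)

lemma ecard_infinite: "infinite A \<Longrightarrow> ecard A = \<infinity>"
  by (simp add: ecard_def)

lemma ecard_empty [simp]: "ecard {} = 0"
  by (simp add: ecard_def zero_enat_def)

lemma ecard_eq_0_iff [simp]: "ecard A = 0 \<longleftrightarrow> A = {}"
  by (auto simp: ecard_def zero_enat_def)

lemma ecard_bij_betw: "bij_betw h A B \<Longrightarrow> ecard A = ecard B"
  by (simp add: ecard_def bij_betw_finite bij_betw_same_card)

text \<open>The convention \<open>\<infinity> * 0 = 0\<close> accounts for an infinite set times the
  empty set. With both factors nonempty, the product is infinite as soon as one factor is.\<close>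

lemma ecard_Times: "ecard (A \<times> B) = ecard A * ecard B"
proof (cases "A = {} \<or> B = {}")
  case True
  then show ?thesis by auto
next
  case False
  then have "ecard A \<noteq> 0" "ecard B \<noteq> 0" by simp_all
  then show ?thesis
    using False
    by (cases "finite A"; cases "finite B")
      (simp_all add: ecard_eq_enat ecard_infinite finite_cartesian_product_iff
        card_cartesian_product imult_is_infinity)
qed

lemma enat_sum: "enat (\<Sum>i\<in>I. g i) = (\<Sum>i\<in>I. enat (g i))"
  by (simp flip: of_nat_eq_enat)

text \<open>One infinite \<open>B i\<close> makes both sides infinite. Finiteness of
  \<open>I\<close> is essential: a sum over an infinite index set is 0 by convention.\<close>

lemma ecard_Sigma:
  assumes "finite I"
  shows "ecard (Sigma I B) = (\<Sum>i\<in>I. ecard (B i))"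
proof (cases "\<forall>i\<in>I. finite (B i)")
  case True
  then have "ecard (Sigma I B) = enat (\<Sum>i\<in>I. card (B i))"
    using assms by (simp add: ecard_eq_enat)
  also have "\<dots> = (\<Sum>i\<in>I. ecard (B i))"
    using True by (simp add: enat_sum ecard_eq_enat)
  finally show ?thesis .
next
  case False
  then obtain i where i: "i \<in> I" "infinite (B i)" by blast
  have "Pair i ` B i \<subseteq> Sigma I B" using i by auto
  moreover have "infinite (Pair i ` B i)"
    using i by (simp add: inj_on_def)
  ultimately have "infinite (Sigma I B)" by (meson finite_subset)
  moreover have "(\<Sum>i\<in>I. ecard (B i)) = \<infinity>"
    using i by (subst sum.remove[OF assms i(1)]) (simp add: ecard_infinite)
  ultimately show ?thesis by (simp add: ecard_infinite)
qed

section \<open>Linear representations from automata\<close>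

lemma recognizable_series_cong:
  assumes "\<And>w. w \<in> lists A \<Longrightarrow> s w = t w"
  shows "recognizable_series A s \<longleftrightarrow> recognizable_series A t"
  unfolding recognizable_series_def using assms by simp

text \<open>A representation indexed by a finite set \<open>Q\<close> of naturals is padded with zero rows and
  columns to one indexed by an initial segment.\<close>

lemma recognizable_seriesI:
  fixes N :: "nat \<Rightarrow> 'b list \<Rightarrow> 'k :: semiring_1"
  assumes Q: "finite Q"
    and step: "\<And>q b w. q \<in> Q \<Longrightarrow> b \<in> A \<Longrightarrow> w \<in> lists A \<Longrightarrow>
                 N q (b # w) = (\<Sum>p\<in>Q. m b q p * N p w)"
    and s: "\<And>w. w \<in> lists A \<Longrightarrow> s w = (\<Sum>q\<in>Q. l q * N q w)"
  shows "recognizable_series A s"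
proof -
  \<comment> \<open>Inserting 0 keeps \<open>Max\<close> defined for empty \<open>Q\<close>; the
    successor makes every element of \<open>Q\<close> an index below \<open>r\<close> and gives
    \<open>r \<ge> 1\<close>.\<close>
  define r where "r = Suc (Max (insert 0 Q))"
  have r: "r \<ge> 1"
    by (simp add: r_def)
  have Qr: "Q \<subseteq> {0..<r}"
    using Q by (auto simp: r_def less_Suc_eq_le)
  define M where "M b = mat r r (\<lambda>(i, j). if i \<in> Q \<and> j \<in> Q then m b i j else 0)" for b
  define \<mu> where "\<mu> w = foldr (\<lambda>b P. M b * P) w (1\<^sub>m r)" for w
  define col_of where "col_of w = mat r 1 (\<lambda>(i, j). if i \<in> Q then N i w else 0)" for w
  define lam where "lam = mat 1 r (\<lambda>(i, j). if j \<in> Q then l j else 0)"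
  have M: "M b \<in> carrier_mat r r" for b
    by (simp add: M_def)
  have \<mu>: "\<mu> w \<in> carrier_mat r r" for w
    by (induction w) (simp_all add: \<mu>_def mult_carrier_mat[OF M])
  have \<mu>_Cons: "\<mu> (b # w) = M b * \<mu> w" for b w
    by (simp add: \<mu>_def)
  have \<mu>_append: "\<mu> (u @ v) = \<mu> u * \<mu> v" for u v
  proof (induction u)
    case Nil
    then show ?case using \<mu>[of v] by (simp add: \<mu>_def[of "[]"])
  next
    case (Cons b u)
    then show ?case using assoc_mult_mat[OF M \<mu> \<mu>] by (simp add: \<mu>_Cons)
  qed
  have restrict: "(\<Sum>j\<in>{0..<r}. if j \<in> Q then g j else 0) = (\<Sum>j\<in>Q. g j)" for g :: "nat \<Rightarrow> 'k"
    using Qr by (simp add: sum.inter_restrict[symmetric] Int_absorb1)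
  have col_of: "col_of w \<in> carrier_mat r 1" for w
    by (simp add: col_of_def)
  \<comment> \<open>The recurrence \<open>step\<close> amounts to
    \<open>M b * col_of w = col_of (b # w)\<close>, so prepending the letters one by one carries the
    final vector \<open>col_of []\<close> to \<open>col_of w\<close>.\<close>
  have \<mu>_col: "\<mu> w * col_of [] = col_of w" if "w \<in> lists A" for w
    using that
  proof (induction w)
    case Nil
    then show ?case by (simp add: \<mu>_def col_of_def)
  next
    case (Cons b w)
    have "\<mu> (b # w) * col_of [] = M b * col_of w"
      using Cons assoc_mult_mat[OF M \<mu> col_of] by (simp add: \<mu>_Cons)
    also have "\<dots> = col_of (b # w)"
    proof (rule eq_matI)
      fix i j assume ij: "i < dim_row (col_of (b # w))" "j < dim_col (col_of (b # w))"
      then have i: "i < r" and j: "j = 0" by (simp_all add: col_of_def)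
      have "(M b * col_of w) $$ (i, j)
          = (\<Sum>p\<in>{0..<r}. if p \<in> Q then (if i \<in> Q then m b i p else 0) * N p w else 0)"
        using i j by (auto simp: M_def col_of_def scalar_prod_def intro!: sum.cong)
      also have "\<dots> = (if i \<in> Q then N i (b # w) else 0)"
        using Cons by (simp add: restrict step)
      finally show "(M b * col_of w) $$ (i, j) = col_of (b # w) $$ (i, j)"
        using i j by (simp add: col_of_def)
    qed (simp_all add: M_def col_of_def)
    finally show ?case .
  qed
  have lam: "lam \<in> carrier_mat 1 r"
    by (simp add: lam_def)
  have "s w = (lam * \<mu> w * col_of []) $$ (0, 0)" if "w \<in> lists A" for w
  proof -
    have "(lam * \<mu> w * col_of []) $$ (0, 0) = (lam * col_of w) $$ (0, 0)"
      using assoc_mult_mat[OF lam \<mu> col_of] \<mu>_col[OF that] by simp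
    also have "\<dots> = (\<Sum>q\<in>{0..<r}. if q \<in> Q then l q * N q w else 0)"
      by (use r in \<open>auto simp: lam_def col_of_def scalar_prod_def intro!: sum.cong\<close>)
    finally show ?thesis using s[OF that] by (simp only: restrict)
  qed
  moreover have "\<mu> [] = 1\<^sub>m r"
    by (simp add: \<mu>_def)
  ultimately show ?thesis
    unfolding recognizable_series_def using r \<mu> \<mu>_append lam col_of by blast
qed

text \<open>Over a preimage of \<open>w\<close>, an automaton first reads a word \<open>z\<close> of letters that project to the
  padding letter \<open>e\<close>, then a word \<open>v\<close> that projects to \<open>w\<close>. Only the first factor can range over
  an infinite set, and it is counted by the initial vector. For the version over \<open>\<nat>\<close>, an infinite
  entry of this vector is replaced by \<open>card = 0\<close>: if all fibres are finite, then such an entry is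
  only ever multiplied by 0.\<close>

lemma recognizable_series_fibre_count:
  fixes pr :: "'c \<Rightarrow> 'b" and e :: 'b
  assumes reg: "regular_language C L"
  defines "fibre \<equiv> \<lambda>w. {u \<in> L. \<exists>k. map pr u = replicate k e @ w}"
  shows "recognizable_series A (\<lambda>w. ecard (fibre w))"
    and "(\<And>w. w \<in> lists A \<Longrightarrow> finite (fibre w)) \<Longrightarrow>
           recognizable_series A (\<lambda>w. card (fibre w))"
proof -
  from reg obtain Q :: "nat set" and q0 F \<delta> where
    C: "finite C" and L: "L \<subseteq> lists C" and Q: "finite Q" "q0 \<in> Q"
    and \<delta>: "\<forall>q\<in>Q. \<forall>a\<in>C. \<delta> q a \<in> Q"
    and acc: "\<forall>w\<in>lists C. w \<in> L \<longleftrightarrow> foldl \<delta> q0 w \<in> F"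
    unfolding regular_language_def by blast
  have run: "foldl \<delta> q v \<in> Q" if "v \<in> lists C" "q \<in> Q" for q v
    using that \<delta> by (induction v arbitrary: q) auto
  define V where "V q w = {v \<in> lists C. map pr v = w \<and> foldl \<delta> q v \<in> F}" for q w
  define Z where "Z q = {z \<in> lists C. pr ` set z \<subseteq> {e} \<and> foldl \<delta> q0 z = q}" for q
  define T where "T b q p = {c \<in> C. pr c = b \<and> \<delta> q c = p}" for b q p
  have finV: "finite (V q w)" for q w
    by (rule finite_subset[OF _ finite_lists_length_eq[OF C, of "length w"]])
      (auto simp: V_def)
  have finT: "finite (T b q p)" for b q p
    using C by (simp add: T_def)
  have step: "card (V q (b # w)) = (\<Sum>p\<in>Q. card (T b q p) * card (V p w))"
    if "q \<in> Q" for q b w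
  proof -
    \<comment> \<open>Words are sorted by the state \<open>p\<close> reached after their first
      letter \<open>c\<close>; since \<open>p\<close> is forced to be \<open>\<delta> q c\<close>,
      each word is counted once.\<close>
    have "bij_betw (\<lambda>(p, c, v). c # v) (SIGMA p:Q. T b q p \<times> V p w) (V q (b # w))"
      unfolding bij_betw_def
    proof
      show "inj_on (\<lambda>(p, c, v). c # v) (SIGMA p:Q. T b q p \<times> V p w)"
        by (auto simp: inj_on_def T_def)
      show "(\<lambda>(p, c, v). c # v) ` (SIGMA p:Q. T b q p \<times> V p w) = V q (b # w)"
      proof (intro equalityI subsetI)
        fix u assume "u \<in> V q (b # w)"
        then obtain c v where u: "u = c # v" "c \<in> C" "pr c = b" "v \<in> lists C" "map pr v = w"
          "foldl \<delta> (\<delta> q c) v \<in> F"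
          by (cases u) (auto simp: V_def)
        then have "(\<delta> q c, c, v) \<in> (SIGMA p:Q. T b q p \<times> V p w)"
          using \<delta> that by (auto simp: T_def V_def)
        then show "u \<in> (\<lambda>(p, c, v). c # v) ` (SIGMA p:Q. T b q p \<times> V p w)"
          using u(1) by force
      qed (auto simp: T_def V_def)
    qed
    from bij_betw_same_card[OF this] show ?thesis
      using Q finT finV by (simp add: card_cartesian_product)
  qed
  have bij: "bij_betw (\<lambda>(q, z, v). z @ v) (SIGMA q:Q. Z q \<times> V q w) (fibre w)" for w
    unfolding bij_betw_def
  proof
    show "inj_on (\<lambda>(q, z, v). z @ v) (SIGMA q:Q. Z q \<times> V q w)"
    proof (rule inj_onI)
      fix x y assume xy: "x \<in> (SIGMA q:Q. Z q \<times> V q w)" "y \<in> (SIGMA q:Q. Z q \<times> V q w)"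
        and eq: "(\<lambda>(q, z, v). z @ v) x = (\<lambda>(q, z, v). z @ v) y"
      obtain q z v q' z' v' where [simp]: "x = (q, z, v)" "y = (q', z', v')"
        by (metis prod.exhaust)
      \<comment> \<open>The cut between \<open>z\<close> and \<open>v\<close> is found from lengths,
        as \<open>v\<close> is as long as \<open>w\<close>; it is unique even if \<open>w\<close>
        itself begins with \<open>e\<close>. The state is then determined by
        \<open>z\<close>.\<close>
      have "map pr v = map pr v'"
        using xy by (simp add: V_def)
      then have "length v = length v'"
        by (rule map_eq_imp_length_eq)
      then show "x = y"
        using xy eq by (auto simp: Z_def)
    qed
    show "(\<lambda>(q, z, v). z @ v) ` (SIGMA q:Q. Z q \<times> V q w) = fibre w"
    proof (intro equalityI subsetI)
      fix u assume "u \<in> (\<lambda>(q, z, v). z @ v) ` (SIGMA q:Q. Z q \<times> V q w)"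
      then obtain q z v where u: "u = z @ v" "z \<in> Z q" "v \<in> V q w"
        by auto
      then have "u \<in> lists C" "foldl \<delta> q0 u \<in> F"
        by (auto simp: Z_def V_def)
      moreover have "map pr z = replicate (length z) e"
        using u(2) by (intro replicate_eqI) (auto simp: Z_def)
      ultimately show "u \<in> fibre w"
        using acc u by (auto simp: fibre_def V_def)
    next
      fix u assume "u \<in> fibre w"
      then obtain k where u: "u \<in> L" "map pr u = replicate k e @ w"
        by (auto simp: fibre_def)
      define z v where "z = take k u" and "v = drop k u"
      have zv: "u = z @ v" "map pr z = replicate k e" "map pr v = w"
        using u(2) by (simp_all add: z_def v_def flip: take_map drop_map)
      have "u \<in> lists C"
        using u(1) L by blast
      then have lists: "z \<in> lists C" "v \<in> lists C"
        using zv(1) by simp_all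
      have "pr ` set z \<subseteq> {e}"
        using arg_cong[OF zv(2), of set] by auto
      moreover have "foldl \<delta> q0 u \<in> F"
        using acc \<open>u \<in> lists C\<close> u(1) by blast
      ultimately have "(foldl \<delta> q0 z, z, v) \<in> (SIGMA q:Q. Z q \<times> V q w)"
        using zv lists run[OF lists(1) Q(2)] by (simp add: Z_def V_def)
      then show "u \<in> (\<lambda>(q, z, v). z @ v) ` (SIGMA q:Q. Z q \<times> V q w)"
        using zv(1) by force
    qed
  qed
  show "recognizable_series A (\<lambda>w. ecard (fibre w))"
  proof (rule recognizable_seriesI[OF Q(1)])
    fix w
    show "ecard (fibre w) = (\<Sum>q\<in>Q. ecard (Z q) * of_nat (card (V q w)))"
      using ecard_bij_betw[OF bij[of w]] Q finV
      by (simp add: ecard_Sigma ecard_Times ecard_eq_enat of_nat_eq_enat)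
  next
    fix q b w assume "q \<in> Q"
    then show "of_nat (card (V q (b # w)))
        = (\<Sum>p\<in>Q. of_nat (card (T b q p)) * of_nat (card (V p w)) :: enat)"
      by (simp add: step)
  qed
  show "recognizable_series A (\<lambda>w. card (fibre w))"
    if fin: "\<And>w. w \<in> lists A \<Longrightarrow> finite (fibre w)"
  proof (rule recognizable_seriesI[OF Q(1), where m = "\<lambda>b q p. card (T b q p)"])
    fix w assume "w \<in> lists A"
    then have "finite (SIGMA q:Q. Z q \<times> V q w)"
      using fin bij_betw_finite[OF bij] by blast
    moreover have "Z q \<times> V q w \<subseteq> snd ` (SIGMA q:Q. Z q \<times> V q w)" if "q \<in> Q" for q
      using that by force
    ultimately have "\<forall>q\<in>Q. finite (Z q \<times> V q w)"
      by (meson finite_imageI finite_subset)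
    then show "card (fibre w) = (\<Sum>q\<in>Q. card (Z q) * card (V q w))"
      using bij_betw_same_card[OF bij[of w]] Q
      by (simp add: card_cartesian_product)
  qed (rule step)
qed

section \<open>Numeration systems\<close>

lemma finite_lenlex_predecessors:
  assumes "finite A" "L \<subseteq> lists A"
  shows "finite {v \<in> L. (v, w) \<in> lenlex r}"
  by (rule finite_subset[OF _ finite_lists_length_le[OF assms(1), of "length w"]])
    (use assms(2) lenlex_length in blast)

text \<open>Different lengths decide at once; for equal lengths, different first letters decide, and
  equal ones leave the tails to the induction.\<close>

lemma lenlex_linear:
  assumes "total_on A r" "u \<in> lists A" "v \<in> lists A" "u \<noteq> v"
  shows "(u, v) \<in> lenlex r \<or> (v, u) \<in> lenlex r"
  using assms(2-)
proof (induction u arbitrary: v)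
  case (Cons a u)
  then show ?case
  proof (cases v)
    case (Cons b v')
    then show ?thesis
      using Cons.prems Cons.IH[of v'] Cons.hyps assms(1)
      by (cases "length u" "length v'" rule: linorder_cases; cases "a = b")
        (auto simp: Cons_lenlex_iff total_on_def)
  qed simp
qed simp

text \<open>\<open>rank w\<close> is the number of predecessors of \<open>w\<close>; it maps the predecessors of \<open>w\<close> injectively,
  hence onto, \<open>{..<rank w}\<close>, so its infinite range is an initial segment of \<open>\<nat>\<close>.\<close>

lemma bij_betw_rep:
  assumes "abstract_numsys S"
  shows "bij_betw (rep S) UNIV (lang S)"
proof -
  let ?r = "less_rel S"
  define pred where "pred w = {v \<in> lang S. (v, w) \<in> lenlex ?r}" for w
  define rank where "rank w = card (pred w)" for w
  have lists: "lang S \<subseteq> lists (alph S)" and inf: "infinite (lang S)" and fin: "finite (alph S)"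
    and ord: "trans ?r" "irrefl ?r" "total_on (alph S) ?r"
    using assms
    by (auto simp: abstract_numsys_def regular_language_def strict_linear_order_on_def)
  have fin_pred: "finite (pred w)" for w
    unfolding pred_def by (rule finite_lenlex_predecessors[OF fin lists])
  have mono: "rank v < rank w" if "v \<in> pred w" for v w
  proof -
    have "(v, v) \<notin> lenlex ?r"
      using ord(2) by (intro lenlex_irreflexive) (simp add: irrefl_def)
    then have "pred v \<subset> pred w"
      using that lenlex_trans[OF _ _ ord(1)] by (auto simp: pred_def)
    then show ?thesis
      unfolding rank_def by (rule psubset_card_mono[OF fin_pred])
  qed
  have inj: "inj_on rank (lang S)"
  proof (rule inj_onI, rule ccontr)
    fix u v assume uv: "u \<in> lang S" "v \<in> lang S" "rank u = rank v" "u \<noteq> v"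
    then have "u \<in> pred v \<or> v \<in> pred u"
      using lenlex_linear[OF ord(3)] lists by (auto simp: pred_def)
    then show False
      using mono uv(3) by fastforce
  qed
  have initial: "rank ` pred w = {..<rank w}" for w
  proof (rule card_subset_eq)
    have "inj_on rank (pred w)"
      using inj by (rule inj_on_subset) (auto simp: pred_def)
    then show "card (rank ` pred w) = card {..<rank w}"
      by (simp add: card_image flip: rank_def)
  qed (use mono in auto)
  have "rank ` lang S = UNIV"
  proof -
    have "infinite (rank ` lang S)"
      using inf inj by simp
    have "n \<in> rank ` lang S" for n
    proof -
      obtain w where "n < rank w"
        using \<open>infinite (rank ` lang S)\<close> by (auto simp: infinite_nat_iff_unbounded)
      then have "n \<in> rank ` pred w" by (simp add: initial)
      then show ?thesis by (auto simp: pred_def)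
    qed
    then show ?thesis by blast
  qed
  with inj have bij: "bij_betw rank (lang S) UNIV"
    by (simp add: bij_betw_def)
  \<comment> \<open>The \<open>THE\<close> in the definition of \<open>rep\<close> picks the word of
    \<open>lang S\<close> with rank \<open>n\<close>, which is literally how
    \<open>the_inv_into\<close> is defined.\<close>
  have "rep S = the_inv_into (lang S) rank"
    by (simp add: rep_def the_inv_into_def rank_def pred_def fun_eq_iff)
  with bij_betw_the_inv_into[OF bij] show ?thesis
    by simp
qed

section \<open>Words read in parallel\<close>

definition max_length :: "'a list list \<Rightarrow> nat" where
  "max_length ws = Max (length ` set ws)"

lemma length_le_max_length: "w \<in> set ws \<Longrightarrow> length w \<le> max_length ws"
  by (simp add: max_length_def)

lemma parallel_altdef:
  "parallel ws = map (\<lambda>i. map (\<lambda>w. left_pad (max_length ws) w ! i) ws) [0..<max_length ws]"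
  by (simp add: parallel_def max_length_def Let_def)

lemma length_left_pad: "length w \<le> m \<Longrightarrow> length (left_pad m w) = m"
  by (simp add: left_pad_def)

text \<open>Deleting every \<open>None\<close> from a padded word gives the word back, whatever the
  amount of padding; hence \<open>m\<close> and \<open>n\<close> may differ.\<close>

lemma left_pad_cancel:
  assumes "left_pad m v = left_pad n w"
  shows "v = w"
proof -
  have "map the (filter (\<lambda>a. a \<noteq> None) (left_pad k u)) = u" for k and u :: "'a list"
    by (simp add: left_pad_def o_def filter_map)
  from this[of m v] this[of n w] show ?thesis
    using assms by simp
qed

lemma column_parallel:
  assumes "j < length ws"
  shows "map (\<lambda>c. c ! j) (parallel ws) = left_pad (max_length ws) (ws ! j)"
  using assms length_left_pad[OF length_le_max_length[of "ws ! j" ws]]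
  by (intro nth_equalityI) (simp_all add: parallel_altdef)

text \<open>Each track determines its word once the padding is removed. The number of words must be
  fixed separately: any positive number of empty words gives the empty word in parallel.\<close>

lemma parallel_inj:
  assumes "parallel vs = parallel ws" "length vs = length ws"
  shows "vs = ws"
proof (rule nth_equalityI)
  fix j assume j: "j < length vs"
  then have "left_pad (max_length vs) (vs ! j) = left_pad (max_length ws) (ws ! j)"
    using column_parallel[OF j] column_parallel[of j ws] assms by simp
  then show "vs ! j = ws ! j"
    by (rule left_pad_cancel)
qed (fact assms(2))

text \<open>A word of maximal length receives no padding, so its track makes the first letter differ
  from the all-\<open>None\<close> letter. Words without leading padding letters serve as normal
  forms.\<close>

lemma dropWhile_parallel:
  assumes "ws \<noteq> []"
  shows "dropWhile ((=) (replicate (length ws) None)) (parallel ws) = parallel ws"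
proof (cases "max_length ws")
  case 0
  then show ?thesis by (simp add: parallel_altdef)
next
  case (Suc m)
  have "max_length ws \<in> length ` set ws"
    unfolding max_length_def using assms by (intro Max_in) auto
  then obtain w where w: "w \<in> set ws" "length w = max_length ws" by auto
  then have "left_pad (max_length ws) w ! 0 \<noteq> None"
    using Suc by (simp add: left_pad_def)
  moreover have "left_pad (max_length ws) w ! 0 \<in> set (map (\<lambda>w. left_pad (max_length ws) w ! 0) ws)"
    using w(1) by auto
  ultimately have "map (\<lambda>w. left_pad (max_length ws) w ! 0) ws \<noteq> replicate (length ws) None"
    by (metis in_set_replicate)
  then show ?thesis
    using Suc by (auto simp: parallel_altdef upt_conv_Cons simp del: upt_Suc)
qed

text \<open>Inside \<open>vs @ ws\<close> the first tracks are padded to the maximal length over all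
  words instead of over \<open>vs\<close>. The surplus positions, \<open>k\<close> in number, carry
  \<open>None\<close> on every track of \<open>vs\<close>.\<close>

lemma parallel_append:
  assumes "vs \<noteq> []"
  shows "\<exists>k. map (take (length vs)) (parallel (vs @ ws))
           = replicate k (replicate (length vs) None) @ parallel vs"
proof
  let ?m = "max_length vs" and ?n = "max_length (vs @ ws)"
  have mn: "?m \<le> ?n"
    unfolding max_length_def using assms by (intro Max_mono) auto
  have pad: "left_pad ?n v ! i = (if i < ?n - ?m then None else left_pad ?m v ! (i - (?n - ?m)))"
    if "v \<in> set vs" for v i
  proof -
    have "left_pad ?n v = replicate (?n - ?m) None @ left_pad ?m v"
      using mn length_le_max_length[OF that]
      by (simp add: left_pad_def flip: replicate_add append_assoc)
    then show ?thesis by (simp add: nth_append)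
  qed
  show "map (take (length vs)) (parallel (vs @ ws))
      = replicate (?n - ?m) (replicate (length vs) None) @ parallel vs"
    using mn pad
    by (intro nth_equalityI)
      (auto simp: parallel_altdef[of vs] parallel_altdef[of "vs @ ws"] nth_append
        map_replicate_const[symmetric] cong: map_cong)
qed

section \<open>Multidimensional representations and leading padding\<close>

lemma dropWhile_replicate_append:
  "dropWhile ((=) e) (replicate k e @ w) = dropWhile ((=) e) w"
  by (induction k) auto

text \<open>Apply \<open>bij_betw_rep\<close> in each component, then \<open>parallel_inj\<close>,
  since all lists involved have length \<open>length Ts\<close>.\<close>

lemma multi_rep_bij:
  assumes "\<forall>T\<in>set Ts. abstract_numsys T"
  shows "bij_betw (multi_rep Ts) (points (length Ts)) (multi_lang Ts)"
  unfolding bij_betw_def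
proof
  have bij: "bij_betw (rep (Ts ! i)) UNIV (lang (Ts ! i))" if "i < length Ts" for i
    using assms that by (simp add: bij_betw_rep)
  show "inj_on (multi_rep Ts) (points (length Ts))"
  proof (rule inj_onI)
    fix x y assume xy: "x \<in> points (length Ts)" "y \<in> points (length Ts)"
      and eq: "multi_rep Ts x = multi_rep Ts y"
    have eq': "map2 rep Ts x = map2 rep Ts y"
      by (rule parallel_inj) (use xy eq in \<open>simp_all add: multi_rep_def points_def\<close>)
    show "x = y"
    proof (rule nth_equalityI)
      fix i assume "i < length x"
      then have i: "i < length Ts" "i < length x" "i < length y"
        using xy by (simp_all add: points_def)
      then have "rep (Ts ! i) (x ! i) = rep (Ts ! i) (y ! i)"
        using arg_cong[OF eq', of "\<lambda>zs. zs ! i"] by simp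
      then show "x ! i = y ! i"
        using bij[OF i(1)] by (auto simp: bij_betw_def dest: injD)
    qed (use xy in \<open>simp add: points_def\<close>)
  qed
  have "map2 rep Ts ` points (length Ts) = {ws. list_all2 (\<lambda>w T. w \<in> lang T) ws Ts}"
  proof (intro equalityI subsetI)
    fix ws assume "ws \<in> {ws. list_all2 (\<lambda>w T. w \<in> lang T) ws Ts}"
    then have len: "length ws = length Ts" and ws: "\<And>i. i < length Ts \<Longrightarrow> ws ! i \<in> lang (Ts ! i)"
      by (auto simp: list_all2_conv_all_nth)
    have "\<exists>n. rep (Ts ! i) n = ws ! i" if "i < length Ts" for i
      using bij[OF that] ws[OF that] by (auto simp: bij_betw_def image_iff) (metis rangeE)
    then obtain g where "\<And>i. i < length Ts \<Longrightarrow> rep (Ts ! i) (g i) = ws ! i"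
      by metis
    then have "ws = map2 rep Ts (map g [0..<length Ts])"
      using len by (intro nth_equalityI) simp_all
    then show "ws \<in> map2 rep Ts ` points (length Ts)"
      by (auto simp: points_def)
  qed (auto simp: points_def list_all2_conv_all_nth bij_betw_apply[OF bij])
  from arg_cong[OF this, of "image parallel"]
  show "multi_rep Ts ` points (length Ts) = multi_lang Ts"
    by (simp add: multi_lang_def multi_rep_def image_image)
qed

lemma multi_rep_append:
  assumes "Ss \<noteq> []" "length n = length Ss"
  shows "\<exists>k. map (take (length Ss)) (multi_rep (Ss @ Ss') (n @ n'))
           = replicate k (replicate (length Ss) None) @ multi_rep Ss n"
proof -
  have "map2 rep Ss n \<noteq> []"
    using assms by (cases Ss; cases n) auto
  from parallel_append[OF this, of "map2 rep Ss' n'"] show ?thesis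
    using assms(2) by (simp add: multi_rep_def)
qed

lemma dropWhile_multi_rep:
  assumes "Ss \<noteq> []" "length n = length Ss"
  shows "dropWhile ((=) (replicate (length Ss) None)) (multi_rep Ss n) = multi_rep Ss n"
proof -
  have "map2 rep Ss n \<noteq> []"
    using assms by (cases Ss; cases n) auto
  from dropWhile_parallel[OF this] show ?thesis
    using assms(2) by (simp add: multi_rep_def)
qed

theorem theorem7p8:
  fixes Ss Ss' :: "'a numsys list"
    and X :: "nat list set"
    and f :: "nat list \<Rightarrow> enat"
  assumes "multi_numsys Ss"
    and "multi_numsys Ss'"
    and "recognizable_set (Ss @ Ss') X"
    and f: "\<And>n. n \<in> points (length Ss) \<Longrightarrow>
              f n = ecard {n' \<in> points (length Ss'). n @ n' \<in> X}"
  shows "regular_sequence Ss f \<and>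
    (f ` points (length Ss) \<subseteq> range enat \<longrightarrow> regular_sequence Ss (\<lambda>n. the_enat (f n)))"
proof -
  let ?d = "length Ss" and ?d' = "length Ss'"
  let ?e = "replicate ?d None :: 'a option list"
  let ?R = "multi_rep (Ss @ Ss')"
  \<comment> \<open>This is \<open>fibre\<close> of the counting lemma with \<open>take ?d\<close>
    as projection and \<open>?e\<close> as padding letter, so that its results apply
    verbatim.\<close>
  define fibre where "fibre w = {u \<in> ?R ` X. \<exists>k. map (take ?d) u = replicate k ?e @ w}" for w
  have ne: "Ss \<noteq> []" and sys: "\<forall>T\<in>set Ss. abstract_numsys T" "\<forall>T\<in>set (Ss @ Ss'). abstract_numsys T"
    and X: "X \<subseteq> points (?d + ?d')" and reg: "regular_language (multi_alph (Ss @ Ss')) (?R ` X)"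
    using assms(1-3) by (auto simp: multi_numsys_def recognizable_set_def)
  note bij = multi_rep_bij[OF sys(1)]
  have inj: "inj_on ?R X"
    using multi_rep_bij[OF sys(2)] X by (auto simp: bij_betw_def intro: inj_on_subset)
  have split: "\<exists>p p'. x = p @ p' \<and> length p = ?d \<and> length p' = ?d'" if "x \<in> X" for x
    using that X by (intro exI[of _ "take ?d x"] exI[of _ "drop ?d x"]) (auto simp: points_def)
  \<comment> \<open>Stripping leading padding letters from the projection removes both the unknown
    \<open>k\<close> and the padding caused by longer words for \<open>p'\<close>; the word of
    \<open>p\<close> itself has none to lose.\<close>
  have strip: "multi_rep Ss p = dropWhile ((=) ?e) w"
    if "length p = ?d" "map (take ?d) (?R (p @ p')) = replicate k ?e @ w" for p p' k w
    using multi_rep_append[OF ne that(1), of Ss' p'] that(2) dropWhile_multi_rep[OF ne that(1)]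
    by (metis dropWhile_replicate_append)
  \<comment> \<open>This identifies \<open>f n\<close> with the cardinality of a fibre. Onto: a word
    of the fibre comes from some \<open>p @ p'\<close> in \<open>X\<close>, and \<open>strip\<close>
    with injectivity of \<open>multi_rep Ss\<close> forces \<open>p = n\<close>.\<close>
  have fibre_rep: "bij_betw (\<lambda>n'. ?R (n @ n')) {n' \<in> points ?d'. n @ n' \<in> X} (fibre (multi_rep Ss n))"
    if n: "n \<in> points ?d" for n
    unfolding bij_betw_def
  proof
    have len: "length n = ?d" using n by (simp add: points_def)
    show "inj_on (\<lambda>n'. ?R (n @ n')) {n' \<in> points ?d'. n @ n' \<in> X}"
      using inj by (auto simp: inj_on_def)
    show "(\<lambda>n'. ?R (n @ n')) ` {n' \<in> points ?d'. n @ n' \<in> X} = fibre (multi_rep Ss n)"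
    proof (intro equalityI subsetI)
      fix u assume "u \<in> fibre (multi_rep Ss n)"
      then obtain p p' k where u: "p @ p' \<in> X" "length p = ?d" "length p' = ?d'" "u = ?R (p @ p')"
        "map (take ?d) u = replicate k ?e @ multi_rep Ss n"
        unfolding fibre_def using split by blast
      then have "multi_rep Ss p = multi_rep Ss n"
        using strip dropWhile_multi_rep[OF ne len] by metis
      then have "p = n"
        using bij u(2) n by (auto simp: bij_betw_def inj_on_def points_def)
      then show "u \<in> (\<lambda>n'. ?R (n @ n')) ` {n' \<in> points ?d'. n @ n' \<in> X}"
        using u by (auto simp: points_def)
    qed (use multi_rep_append[OF ne len] in \<open>auto simp: fibre_def\<close>)
  qed
  \<comment> \<open>The series to be represented is 0 off \<open>multi_lang Ss\<close>. As
    \<open>multi_alph Ss\<close> excludes \<open>?e\<close>, the word \<open>w\<close> is already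
    stripped, and a nonempty fibre would make it the word of some \<open>p\<close>.\<close>
  have fibre_outside: "fibre w = {}" if "w \<in> lists (multi_alph Ss)" "w \<notin> multi_lang Ss" for w
  proof (rule ccontr)
    assume "fibre w \<noteq> {}"
    then obtain p p' k where u: "length p = ?d" "map (take ?d) (?R (p @ p')) = replicate k ?e @ w"
      unfolding fibre_def using split by blast
    have "dropWhile ((=) ?e) w = w"
      using that(1) by (cases w) (auto simp: multi_alph_def)
    then have "w = multi_rep Ss p"
      using strip[OF u] by simp
    then show False
      using bij u(1) that(2) by (auto simp: bij_betw_def points_def)
  qed
  have val: "multi_val Ss w \<in> points ?d \<and> multi_rep Ss (multi_val Ss w) = w" if "w \<in> multi_lang Ss" for w
    using bij bij_betw_apply[OF bij_betw_the_inv_into[OF bij] that]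
      f_the_inv_into_f_bij_betw[OF bij, of w] that
    by (simp add: multi_val_def)
  have series_eq: "(if w \<in> multi_lang Ss then f (multi_val Ss w) else 0) = ecard (fibre w)"
    if "w \<in> lists (multi_alph Ss)" for w
    using val[of w] fibre_outside[OF that] f ecard_bij_betw[OF fibre_rep] by auto
  note counts = recognizable_series_fibre_count[OF reg, where pr = "take ?d" and e = ?e
      and A = "multi_alph Ss", folded fibre_def]
  have "regular_sequence Ss f"
    using counts(1) series_eq unfolding regular_sequence_def
    by (simp cong: recognizable_series_cong)
  moreover have "regular_sequence Ss (\<lambda>n. the_enat (f n))"
    if "f ` points ?d \<subseteq> range enat"
  proof -
    \<comment> \<open>The counting lemma asks for finite fibres over all words, not only over
      representations: the hypothesis on \<open>f\<close> covers the latter, and the remaining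
      fibres are empty.\<close>
    have fin: "finite (fibre w)" if "w \<in> lists (multi_alph Ss)" for w
    proof (cases "w \<in> multi_lang Ss")
      case True
      then have "multi_val Ss w \<in> points ?d"
        using val by blast
      then have "ecard (fibre w) \<in> range enat"
        using series_eq[OF that] True \<open>f ` points ?d \<subseteq> range enat\<close>
        by (metis image_subset_iff)
      then show ?thesis by (auto simp: ecard_def split: if_splits)
    qed (simp add: fibre_outside that)
    have "(if w \<in> multi_lang Ss then the_enat (f (multi_val Ss w)) else 0) = card (fibre w)"
      if "w \<in> lists (multi_alph Ss)" for w
      using series_eq[OF that] fin[OF that] fibre_outside[OF that]
      by (auto simp: ecard_eq_enat split: if_splits)
    then show ?thesis
      using counts(2)[OF fin] unfolding regular_sequence_def
      by (simp cong: recognizable_series_cong)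
  qed
  ultimately show ?thesis by blast
qed

end
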